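(* Let $\alpha<0$ be real and let $n\ge 3$ be an integer. 1) If $n<\varkappa_\alpha$, then $\lambda_{\alpha,n,1}=0$ and $0<\lambda_{\alpha,n,2}<g(d_{n,2})$. 2) If $n=\varkappa_\alpha$, then $\lambda_{\alpha,n,1}=\lambda_{\alpha,n,2}=0$. 3) If $n>\varkappa_\alpha$, then $\Omega_\alpha<\lambda_{\alpha,n,1}<0$ and $\lambda_{\alpha,n,2}=0$. Furthermore, for every integer $j$ with $3\le j\le n$: if $j$ is odd, then $\lambda_{\alpha,n,j}=g(d_{n,j})$; if $j$ is even, then $g(d_{n,j-1})<\lambda_{\alpha,n,j}<g(d_{n,j})$.
   Context: For an integer $n\ge3$ and real $\alpha<0$, $L_{\alpha,n}$ is the real symmetric $n\times n$ matrix whose entries are: $(1,1)$ and $(n,n)$ entries equal to $1+\alpha$; $(1,n)$ and $(n,1)$ entries equal to $-\alpha$; $(k,k)$ entries equal to $2$ for $2\le k\le n-1$; $(k,k+1)$ and $(k+1,k)$ entries equal to $-1$ for $1\le k\le n-1$; all other entries $0$. Its eigenvalues, counted with multiplicity, are $\lambda_{\alpha,n,1}\le\lambda_{\alpha,n,2}\le\dots\le\lambda_{\alpha,n,n}$. Put $\varkappa_\alpha=\frac{\alpha-1}{\alpha}$, $\Omega_\alpha=\frac{4\alpha^2}{2\alpha-1}$, $g(x)=4\sin^2(x/2)$ for $x\in[0,\pi]$, and $d_{n,j}=\frac{(j-1)\pi}{n}$. *)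

theory Defs
  imports
    "Jordan_Normal_Form.Char_Poly"
    "Jordan_Normal_Form.Conjugate"
    "HOL-Computational_Algebra.Fundamental_Theorem_Algebra"
begin

text \<open>Indices are zero-based here: row (column) \<open>i\<close> is row (column) \<open>i + 1\<close> in the usual
  numbering. The matrix is the intended one for \<open>n \<ge> 3\<close>, where the cases are disjoint.\<close>

definition L_mat :: "real \<Rightarrow> nat \<Rightarrow> real mat" where
  "L_mat \<alpha> n = mat n n (\<lambda>(i, j).
     if i = j then (if i = 0 \<or> i = n - 1 then 1 + \<alpha> else 2)
     else if (i = 0 \<and> j = n - 1) \<or> (i = n - 1 \<and> j = 0) then - \<alpha>
     else if j = i + 1 \<or> i = j + 1 then - 1
     else 0)"

text \<open>\<open>proots\<close> is the multiset of roots, so each real eigenvalue occurs according to its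
  algebraic multiplicity. For a symmetric matrix there are no other eigenvalues; see
  \<open>length_eigenvalue_list\<close> below.\<close>

definition eigenvalue_list :: "real mat \<Rightarrow> real list" where
  "eigenvalue_list A = sorted_list_of_multiset (proots (char_poly A))"

text \<open>The index \<open>j\<close> runs from \<open>1\<close> to \<open>n\<close>, whereas list positions start at \<open>0\<close>.\<close>

definition eigval :: "real \<Rightarrow> nat \<Rightarrow> nat \<Rightarrow> real" where
  "eigval \<alpha> n j = eigenvalue_list (L_mat \<alpha> n) ! (j - 1)"

definition kappa :: "real \<Rightarrow> real" where
  "kappa \<alpha> = (\<alpha> - 1) / \<alpha>"

definition Omega :: "real \<Rightarrow> real" where
  "Omega \<alpha> = 4 * \<alpha>\<^sup>2 / (2 * \<alpha> - 1)"

definition g_fun :: "real \<Rightarrow> real" where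
  "g_fun x = 4 * (sin (x / 2))\<^sup>2"

definition d_pt :: "nat \<Rightarrow> nat \<Rightarrow> real" where
  "d_pt n j = (real j - 1) * pi / real n"

lemma L_mat_carrier: "L_mat \<alpha> n \<in> carrier_mat n n"
  by (simp add: L_mat_def)

lemma L_mat_symmetric: "transpose_mat (L_mat \<alpha> n) = L_mat \<alpha> n"
  by (rule eq_matI) (auto simp: L_mat_def)

lemma sorted_eigenvalue_list: "sorted (eigenvalue_list A)"
  by (simp add: eigenvalue_list_def)

lemma set_eigenvalue_list:
  assumes A: "A \<in> carrier_mat n n"
  shows "set (eigenvalue_list A) = {k. eigenvalue A k}"
proof -
  have "char_poly A \<noteq> 0"
    using degree_monic_char_poly[OF A] by auto
  then show ?thesis
    by (simp add: eigenvalue_list_def eigenvalue_root_char_poly[OF A])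
qed

lemma symmetric_eigenvalue_real:
  assumes A: "(A :: real mat) \<in> carrier_mat n n" and sym: "transpose_mat A = A"
    and ev: "eigenvalue (map_mat complex_of_real A) k"
  shows "k \<in> \<real>"
proof -
  let ?B = "map_mat complex_of_real A"
  have B: "?B \<in> carrier_mat n n" using A by simp
  from ev obtain v where v: "v \<in> carrier_vec n" "v \<noteq> 0\<^sub>v n" "?B *\<^sub>v v = k \<cdot>\<^sub>v v"
    using B by (auto simp: eigenvalue_def eigenvector_def)
  have sB: "transpose_mat ?B = ?B"
    using sym by (metis map_mat_transpose)
  have cv: "conjugate v \<in> carrier_vec n" using v by simp
  have cB: "?B *\<^sub>v conjugate v = conjugate (?B *\<^sub>v v)"
    using A v(1) by (intro eq_vecI) (auto simp: scalar_prod_def sum_conjugate conjugate_dist_mul)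
  have "k * (v \<bullet> conjugate v) = (?B *\<^sub>v v) \<bullet> conjugate v"
    using v cv by simp
  also have "\<dots> = v \<bullet> (?B *\<^sub>v conjugate v)"
    using transpose_vec_mult_scalar[OF B cv v(1)] sB by simp
  also have "\<dots> = v \<bullet> (conjugate k \<cdot>\<^sub>v conjugate v)"
    using v by (simp add: cB conjugate_smult_vec)
  also have "\<dots> = conjugate k * (v \<bullet> conjugate v)"
    using v cv by simp
  finally have "k = conjugate k"
    using conjugate_square_eq_0_vec[OF v(1)] v(2) by auto
  then show ?thesis
    by (simp add: Reals_cnj_iff)
qed

lemma length_eigenvalue_list:
  assumes A: "A \<in> carrier_mat n n" and sym: "transpose_mat A = A"
  shows "length (eigenvalue_list A) = n"
proof -
  let ?B = "map_mat complex_of_real A"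
  let ?p = "char_poly A"
  have B: "?B \<in> carrier_mat n n" using A by simp
  have cp: "char_poly ?B = map_poly complex_of_real ?p"
    by (rule of_real_hom.char_poly_hom[OF A])
  obtain as where as: "char_poly ?B = (\<Prod>a\<leftarrow>as. [:- a, 1:])" "length as = n"
    using char_poly_factorized[OF B] by blast
  have re: "complex_of_real (Re a) = a" if "a \<in> set as" for a
  proof -
    have "poly (char_poly ?B) a = 0"
      unfolding as(1) poly_prod_list using that by (auto simp: prod_list_zero_iff)
    then have "eigenvalue ?B a"
      by (simp add: eigenvalue_root_char_poly[OF B])
    then show ?thesis
      using symmetric_eigenvalue_real[OF A sym] by (simp add: of_real_Re)
  qed
  have "map_poly complex_of_real (\<Prod>a\<leftarrow>as. [:- Re a, 1:]) = (\<Prod>a\<leftarrow>as. [:- a, 1:])"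
    using re
  proof (induction as)
    case (Cons a as)
    interpret P: map_poly_comm_ring_hom complex_of_real ..
    have "map_poly complex_of_real ([:- Re a, 1:] * (\<Prod>a\<leftarrow>as. [:- Re a, 1:]))
        = map_poly complex_of_real [:- Re a, 1:] * (\<Prod>a\<leftarrow>as. [:- a, 1:])"
      using Cons by (simp only: P.hom_mult) simp
    moreover have "map_poly complex_of_real [:- Re a, 1:] = [:- a, 1:]"
      using Cons.prems by simp
    ultimately show ?case
      by (simp only: list.map prod_list.Cons)
  qed simp
  then have "?p = (\<Prod>a\<leftarrow>as. [:- Re a, 1:])"
    using as(1) cp by (simp add: poly_eq_iff coeff_map_poly) (metis of_real_eq_iff)
  moreover have "proots (\<Prod>a\<leftarrow>as. [:- Re a, 1:]) = mset (map Re as)"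
  proof (induction as)
    case (Cons a as)
    have "(\<Prod>a\<leftarrow>as. [:- Re a, 1:]) \<noteq> 0"
      by (auto simp: prod_list_zero_iff)
    then have "proots ([:- Re a, 1:] * (\<Prod>a\<leftarrow>as. [:- Re a, 1:]))
        = proots [:- Re a, 1:] + proots (\<Prod>a\<leftarrow>as. [:- Re a, 1:])"
      by (intro proots_mult) auto
    then show ?case
      using Cons.IH by (simp only: list.map prod_list.Cons proots_linear_factor) simp
  qed simp
  ultimately have "proots ?p = mset (map Re as)"
    by simp
  then show ?thesis
    unfolding eigenvalue_list_def size_mset[symmetric] by (simp add: as(2))
qed

end

theory Submission
  imports Defs "Subresultants.More_Homomorphisms"
begin

text \<open>
  The matrix is the Laplacian of a cycle all of whose edges have weight \<open>1\<close> except the one joining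
  the two end vertices, which has weight \<open>\<alpha>\<close>. For a vector \<open>y 1, \<dots>, y n\<close>, extended by fictitious
  entries \<open>y 0\<close> and \<open>y (n + 1)\<close>, the eigenvalue equation becomes the recurrence
  \<open>y k + y (k + 2) = (2 - \<mu>) * y (k + 1)\<close> together with one boundary condition at each end
  (\<open>L_mat_mult_vec\<close>). The flip \<open>k \<mapsto> n + 1 - k\<close> commutes with the matrix, so eigenvectors may be
  sought among symmetric and antisymmetric vectors.

  Symmetric vectors do not feel the weight \<open>\<alpha>\<close>: cosines give the eigenvalues \<open>g_fun (d_pt n j)\<close> for
  odd \<open>j\<close>. In the antisymmetric case, the sine vector of frequency \<open>x\<close>, with \<open>0 < x < pi\<close>, is an
  eigenvector for \<open>g_fun x\<close> as soon as \<open>\<alpha> * sin (n * x / 2) * cos (x / 2) + (1 - \<alpha>) * cos (n * x / 2) * sin (x / 2) = 0\<close>.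
  At each point \<open>d_pt n j\<close> one of the two summands vanishes, so the sign of the left-hand side is
  explicit there, and the intermediate value theorem puts a root strictly between \<open>d_pt n (j - 1)\<close>
  and \<open>d_pt n j\<close> for each even \<open>j \<ge> 4\<close>.

  The remaining antisymmetric eigenvalue is decided by the slope of the left-hand side at \<open>0\<close>, which
  is half of \<open>1 - \<alpha> + \<alpha> * n\<close> and so has the sign of \<open>kappa \<alpha> - n\<close>. A positive slope forces a root
  in the interval from \<open>0\<close> to \<open>d_pt n 2\<close>. With a negative slope, hyperbolic sines take over and the
  same argument yields a negative eigenvalue. With slope zero the antisymmetric vector degenerates to
  one that is linear in \<open>k\<close>; like the constant vector it has eigenvalue \<open>0\<close>, and
  \<open>order_char_poly_ge\<close> turns these two independent eigenvectors into algebraic multiplicity.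

  In every case this exhibits \<open>n\<close> eigenvalues counted with multiplicity. The characteristic polynomial
  of a symmetric matrix has exactly \<open>n\<close> real roots, so there are no others, and putting the
  exhibited ones in order gives the theorem (\<open>spectrum_eqI\<close>).
\<close>

section \<open>Eigenvectors and algebraic multiplicity\<close>

text \<open>Algebraic multiplicity is at least geometric multiplicity. Multiplying the
  characteristic matrix on the right by the constant matrix \<open>S\<close> makes each of the first \<open>k\<close> columns a multiple of
  \<open>[:- \<mu>, 1:]\<close>. These factors can be pulled out of the determinant, and the determinant of \<open>S\<close> is a
  unit in the polynomial ring.\<close>

lemma order_char_poly_ge:
  fixes A S :: "'a :: field mat"
  assumes A: "A \<in> carrier_mat n n" and S: "S \<in> carrier_mat n n" and det: "det S \<noteq> 0"
    and "k \<le> n" and ev: "\<And>j. j < k \<Longrightarrow> A *\<^sub>v col S j = \<mu> \<cdot>\<^sub>v col S j"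
  shows "k \<le> order \<mu> (char_poly A)"
proof -
  define P where "P = char_poly_matrix A"
  define S' where "S' = map_mat coeff_lift S"
  define D where "D = mat n n (\<lambda>(i, j). if i = j then (if j < k then [:- \<mu>, 1:] else 1) else 0)"
  define M where "M = mat n n (\<lambda>(i, j). if j < k then [:S $$ (i, j):] else (P * S') $$ (i, j))"
  have P: "P \<in> carrier_mat n n" and S': "S' \<in> carrier_mat n n" and D: "D \<in> carrier_mat n n"
    and M: "M \<in> carrier_mat n n"
    using A S by (simp_all add: P_def S'_def D_def M_def)
  have "(P * S') $$ (i, j) = [:- \<mu>, 1:] * [:S $$ (i, j):]" if i: "i < n" and j: "j < k" for i j
  proof -
    have jn: "j < n" using j \<open>k \<le> n\<close> by simp
    have "(\<Sum>l<n. A $$ (i, l) * S $$ (l, j)) = (A *\<^sub>v col S j) $ i"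
      using A S i jn by (simp add: scalar_prod_def lessThan_atLeast0)
    also have "\<dots> = \<mu> * S $$ (i, j)"
      using S i jn by (simp add: ev[OF j])
    finally have sum: "(\<Sum>l<n. A $$ (i, l) * S $$ (l, j)) = \<mu> * S $$ (i, j)" .
    have "(P * S') $$ (i, j) = (\<Sum>l<n. P $$ (i, l) * coeff_lift (S $$ (l, j)))"
      using P S S' i jn by (simp add: scalar_prod_def lessThan_atLeast0 S'_def)
    also have "\<dots> = (\<Sum>l<n. (if i = l then [:0, S $$ (l, j):] else 0)
        - coeff_lift (A $$ (i, l) * S $$ (l, j)))"
      using A i by (intro sum.cong) (auto simp: P_def char_poly_matrix_def)
    also have "\<dots> = [:0, S $$ (i, j):] - coeff_lift (\<Sum>l<n. A $$ (i, l) * S $$ (l, j))"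
      using i by (simp add: sum_subtractf coeff_lift_hom.hom_sum)
    also have "\<dots> = [:- \<mu>, 1:] * [:S $$ (i, j):]"
      by (simp add: sum)
    finally show ?thesis .
  qed
  note eigen_columns = this
  have "P * S' = M * D"
  proof (rule eq_matI)
    fix i j assume "i < dim_row (M * D)" "j < dim_col (M * D)"
    then have i: "i < n" and j: "j < n" using M D by auto
    have "(M * D) $$ (i, j) = (\<Sum>l<n. M $$ (i, l) * D $$ (l, j))"
      using M D i j by (simp add: scalar_prod_def lessThan_atLeast0)
    also have "\<dots> = (\<Sum>l<n. if l = j then M $$ (i, j) * D $$ (j, j) else 0)"
      using j by (intro sum.cong) (auto simp: D_def)
    also have "\<dots> = M $$ (i, j) * D $$ (j, j)"
      using j by simp
    also have "\<dots> = (P * S') $$ (i, j)"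
      using i j eigen_columns[of i j] by (auto simp: M_def D_def)
    finally show "(P * S') $$ (i, j) = (M * D) $$ (i, j)" by simp
  qed (use P S' M D in auto)
  then have "det P * det S' = det M * det D"
    using det_mult[OF P S'] det_mult[OF M D] by simp
  moreover have "det S' = [:det S:]"
    by (simp add: S'_def)
  moreover have "det D = [:- \<mu>, 1:] ^ k"
  proof -
    have "det D = prod_list (diag_mat D)"
      by (rule det_upper_triangular[OF _ D]) (auto simp: D_def)
    also have "\<dots> = (\<Prod>i<n. if i < k then [:- \<mu>, 1:] else 1)"
      by (simp add: diag_mat_def D_def prod.list_conv_set_nth lessThan_atLeast0)
    also have "\<dots> = (\<Prod>i<k. [:- \<mu>, 1:])"
      using \<open>k \<le> n\<close> by (intro prod.mono_neutral_cong_right) auto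
    finally show ?thesis by simp
  qed
  ultimately have "Polynomial.smult (det S) (char_poly A) = det M * [:- \<mu>, 1:] ^ k"
    by (simp add: P_def char_poly_def)
  then have "[:- \<mu>, 1:] ^ k dvd Polynomial.smult (det S) (char_poly A)"
    by simp
  then have "[:- \<mu>, 1:] ^ k dvd char_poly A"
    using det by (simp add: dvd_smult_iff)
  moreover have "char_poly A \<noteq> 0"
    using degree_monic_char_poly[OF A] by auto
  ultimately show ?thesis
    using order_divides by blast
qed

text \<open>It suffices to exhibit eigenvalues with lower bounds for their multiplicities: a symmetric
  matrix has exactly \<open>n\<close> real eigenvalues, so \<open>n\<close> exhibited ones exhaust the spectrum.\<close>

lemma eigenvalue_list_eqI:
  assumes A: "A \<in> carrier_mat n n" and sym: "transpose_mat A = A"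
    and len: "length xs = n" and sorted: "sorted xs"
    and mult: "\<And>x. x \<in> set xs \<Longrightarrow> count (mset xs) x \<le> order x (char_poly A)"
  shows "eigenvalue_list A = xs"
proof -
  have nz: "char_poly A \<noteq> 0"
    using degree_monic_char_poly[OF A] by auto
  have "count (mset xs) x \<le> count (proots (char_poly A)) x" for x
  proof (cases "x \<in> set xs")
    case True
    then show ?thesis using mult[of x] nz by simp
  next
    case False
    then have "count (mset xs) x = 0" by simp
    then show ?thesis by linarith
  qed
  then have sub: "mset xs \<subseteq># proots (char_poly A)"
    by (rule mset_subset_eqI)
  have "mset (eigenvalue_list A) = proots (char_poly A)"
    by (simp add: eigenvalue_list_def)
  moreover from this have "size (proots (char_poly A)) = n"
    using length_eigenvalue_list[OF A sym] by (metis size_mset)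
  ultimately have "mset (eigenvalue_list A) = mset xs"
    using sub len by (metis mset_subset_size size_mset subset_mset.order_iff_strict less_irrefl)
  then show ?thesis
    using sorted sorted_eigenvalue_list by (metis properties_for_sort)
qed

section \<open>The eigenvalue equation as a recurrence\<close>

text \<open>The entries \<open>y 0\<close> and \<open>y (n + 1)\<close> lie outside the vector. They let the first and last rows be
  treated like the others: the boundary conditions express the difference between those rows and the
  row \<open>- 1, 2, - 1\<close> continued past the ends.\<close>

lemma L_mat_mult_vec:
  fixes y :: "nat \<Rightarrow> real"
  assumes n: "n \<ge> 3"
    and rec: "\<And>k. k < n \<Longrightarrow> y k + y (k + 2) = (2 - \<mu>) * y (k + 1)"
    and bd1: "y 0 - y 1 + \<alpha> * (y 1 - y n) = 0"
    and bdn: "y (n + 1) - y n + \<alpha> * (y n - y 1) = 0"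
  shows "L_mat \<alpha> n *\<^sub>v vec n (\<lambda>i. y (i + 1)) = \<mu> \<cdot>\<^sub>v vec n (\<lambda>i. y (i + 1))"
proof (rule eq_vecI)
  fix i assume "i < dim_vec (\<mu> \<cdot>\<^sub>v vec n (\<lambda>i. y (i + 1)))"
  then have i: "i < n" by simp
  have "(L_mat \<alpha> n *\<^sub>v vec n (\<lambda>i. y (i + 1))) $ i = (\<Sum>j<n. L_mat \<alpha> n $$ (i, j) * y (j + 1))"
    using i by (simp add: scalar_prod_def lessThan_atLeast0 L_mat_def)
  \<comment> \<open>One summand for each position where a row can be nonzero, so that each sum collapses. The
    guard \<open>i > 0\<close> is needed because \<open>i - 1 = i\<close> in the first row.\<close>
  also have "\<dots> = (\<Sum>j<n. (if j = i then (if i = 0 \<or> i = n - 1 then 1 + \<alpha> else 2) * y (i + 1) else 0)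
      + (if j = n - 1 then (if i = 0 then - \<alpha> * y n else 0) else 0)
      + (if j = 0 then (if i = n - 1 then - \<alpha> * y 1 else 0) else 0)
      + (if j = i + 1 then - y (i + 2) else 0)
      + (if j = i - 1 then (if i > 0 then - y i else 0) else 0))"
    using i n by (intro sum.cong refl) (auto simp: L_mat_def)
  also have "\<dots> = (if i = 0 \<or> i = n - 1 then 1 + \<alpha> else 2) * y (i + 1)
      + (if i = 0 then - \<alpha> * y n else 0) + (if i = n - 1 then - \<alpha> * y 1 else 0)
      + (if i + 1 < n then - y (i + 2) else 0) + (if i > 0 then - y i else 0)"
    using i n unfolding sum.distrib by (simp add: less_imp_diff_less)
  also have "\<dots> = \<mu> * y (i + 1)"
  proof -
    consider "i = 0" | "i = n - 1" | "0 < i" "i < n - 1" using i by linarith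
    then show ?thesis
    proof cases
      case 1
      then show ?thesis using n rec[of 0] bd1 by (simp add: algebra_simps numeral_2_eq_2)
    next
      case 2
      then show ?thesis using n rec[of "n - 1"] bdn
        by (simp add: algebra_simps Suc_diff_Suc numeral_2_eq_2)
    next
      case 3
      moreover from this have "i + 1 < n" by linarith
      ultimately show ?thesis using rec[of i] by (simp add: algebra_simps)
    qed
  qed
  finally show "(L_mat \<alpha> n *\<^sub>v vec n (\<lambda>i. y (i + 1))) $ i = (\<mu> \<cdot>\<^sub>v vec n (\<lambda>i. y (i + 1))) $ i"
    using i by simp
qed (simp add: L_mat_def)

lemma L_mat_eigenvalueI:
  fixes y :: "nat \<Rightarrow> real"
  assumes "n \<ge> 3"
    and "\<And>k. k < n \<Longrightarrow> y k + y (k + 2) = (2 - \<mu>) * y (k + 1)"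
    and "y 0 - y 1 + \<alpha> * (y 1 - y n) = 0"
    and "y (n + 1) - y n + \<alpha> * (y n - y 1) = 0"
    and nz: "i < n" "y (i + 1) \<noteq> 0"
  shows "eigenvalue (L_mat \<alpha> n) \<mu>"
proof -
  have "vec n (\<lambda>i. y (i + 1)) \<noteq> 0\<^sub>v n"
    using nz by (metis index_vec index_zero_vec(1))
  then show ?thesis
    unfolding eigenvalue_def eigenvector_def
    using L_mat_mult_vec[OF assms(1-4)] by (intro exI[of _ "vec n (\<lambda>i. y (i + 1))"])
      (simp add: L_mat_def)
qed

section \<open>The eigenvalue zero\<close>

lemma eigenvalue_zero:
  assumes "n \<ge> 3"
  shows "eigenvalue (L_mat \<alpha> n) 0"
  by (rule L_mat_eigenvalueI[where y = "\<lambda>_. 1" and i = 0]) (use assms in auto)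

text \<open>The assumption is \<open>n = kappa \<alpha>\<close> in a form without division. The constant vector is always in
  the kernel, and a vector whose entries increase by \<open>1\<close> satisfies the boundary conditions exactly
  for this \<open>\<alpha>\<close>.\<close>

lemma order_zero_ge_2:
  assumes n: "n \<ge> 3" and \<alpha>: "\<alpha> * (1 - real n) = 1"
  shows "2 \<le> order 0 (char_poly (L_mat \<alpha> n))"
proof -
  \<comment> \<open>The two kernel vectors, normalised to start with \<open>1, 1\<close> and \<open>0, 1\<close>, are completed by unit
    vectors. The resulting matrix is lower triangular with ones on the diagonal.\<close>
  define S :: "real mat" where "S = mat n n (\<lambda>(i, j).
    if j = 0 then 1 else if j = 1 then real i else if i = j then 1 else 0)"
  have S: "S \<in> carrier_mat n n" by (simp add: S_def)
  have "det S = prod_list (diag_mat S)"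
    by (rule det_lower_triangular[OF _ S]) (auto simp: S_def)
  also have "\<dots> \<noteq> 0"
    by (auto simp: diag_mat_def S_def prod_list_zero_iff)
  finally have det: "det S \<noteq> 0" .
  have ev: "L_mat \<alpha> n *\<^sub>v col S j = 0 \<cdot>\<^sub>v col S j" if j: "j < 2" for j
  proof -
    consider "j = 0" | "j = 1" using j by fastforce
    then show ?thesis
    proof cases
      case 1
      then have "col S j = vec n (\<lambda>i. (\<lambda>_. 1) (i + 1))"
        using n by (auto simp: S_def)
      then show ?thesis
        using L_mat_mult_vec[OF n, of "\<lambda>_. 1" 0 \<alpha>] by simp
    next
      case 2
      then have "col S j = vec n (\<lambda>i. (\<lambda>k. real k - 1) (i + 1))"
        using n by (auto simp: S_def)
      then show ?thesis
        using L_mat_mult_vec[OF n, of "\<lambda>k. real k - 1" 0 \<alpha>] \<alpha> by (simp add: algebra_simps)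
    qed
  qed
  show ?thesis
    by (rule order_char_poly_ge[OF L_mat_carrier S det _ ev]) (use n in auto)
qed

section \<open>Trigonometric and hyperbolic eigenvectors\<close>

text \<open>Half of the defect in the boundary condition of the sine vector with frequency \<open>x\<close>, written in
  terms of \<open>n * x / 2\<close> and \<open>x / 2\<close> so that it is easy to evaluate at the points \<open>d_pt n j\<close>;
  \<open>sinh_boundary\<close> is its analogue for imaginary frequencies.\<close>

definition sin_boundary :: "real \<Rightarrow> nat \<Rightarrow> real \<Rightarrow> real" where
  "sin_boundary \<alpha> n x = \<alpha> * sin (n * x / 2) * cos (x / 2) + (1 - \<alpha>) * cos (n * x / 2) * sin (x / 2)"

definition sinh_boundary :: "real \<Rightarrow> nat \<Rightarrow> real \<Rightarrow> real" where
  "sinh_boundary \<alpha> n t =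
     \<alpha> * sinh (n * t / 2) * cosh (t / 2) + (1 - \<alpha>) * cosh (n * t / 2) * sinh (t / 2)"

lemma g_fun_cos: "g_fun x = 2 - 2 * cos x"
  using cos_double_sin[of "x / 2"] by (simp add: g_fun_def)

lemma g_fun_less:
  assumes "0 \<le> x" "x < y" "y \<le> pi"
  shows "g_fun x < g_fun y"
  using cos_monotone_0_pi[of x y] assms by (simp add: g_fun_cos)

lemma d_pt_mono:
  assumes "n > 0" "i < j"
  shows "d_pt n i < d_pt n j"
  using assms by (simp add: d_pt_def divide_strict_right_mono)

lemma d_pt_nonneg:
  assumes "1 \<le> j"
  shows "0 \<le> d_pt n j"
  using assms by (simp add: d_pt_def)

lemma d_pt_less_pi:
  assumes "j \<le> n" "n > 0"
  shows "d_pt n j < pi"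
proof -
  have "(real j - 1) * pi < real n * pi"
    using assms by (intro mult_strict_right_mono) auto
  then show ?thesis using assms by (simp add: d_pt_def field_simps)
qed

text \<open>Centring the cosine at \<open>1 / 2\<close> makes the vector even about both ends, that is \<open>y 0 = y 1\<close> and
  \<open>y (n + 1) = y n\<close>. For odd \<open>j\<close> it also satisfies \<open>y 1 = y n\<close>, so the boundary conditions hold for
  every \<open>\<alpha>\<close>.\<close>

lemma eigenvalue_cos:
  assumes n: "n \<ge> 3" and j: "odd j" "j \<le> n"
  shows "eigenvalue (L_mat \<alpha> n) (g_fun (d_pt n j))"
proof -
  define x where "x = d_pt n j"
  from j(1) obtain m where m: "j = 2 * m + 1" by (elim oddE)
  have nx: "real n * x = 2 * real m * pi"
    using n by (simp add: x_def d_pt_def m)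
  define y where "y = (\<lambda>k. cos ((real k - 1 / 2) * x))"
  have refl: "cos (2 * real m * pi + z) = cos z" for z
    by (simp only: cos_add cos_2npi sin_2npi mult_1 mult_zero_left diff_zero)
  have yn: "y n = y 1"
  proof -
    have "y n = cos (2 * real m * pi + (- (x / 2)))"
      by (simp add: y_def left_diff_distrib nx)
    then show ?thesis by (simp only: refl) (simp add: y_def)
  qed
  have yn1: "y (n + 1) = y n"
  proof -
    have "y (n + 1) = cos (2 * real m * pi + x / 2)"
      by (simp add: y_def left_diff_distrib distrib_right nx add.commute)
    then show ?thesis unfolding yn by (simp only: refl) (simp add: y_def)
  qed
  have y0: "y 0 = y 1" by (simp add: y_def)
  have "eigenvalue (L_mat \<alpha> n) (g_fun x)"
  proof (rule L_mat_eigenvalueI[OF n, where y = y and i = 0])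
    fix k
    define z where "z = (real k + 1 / 2) * x"
    have "y k = cos (z - x)" "y (k + 2) = cos (z + x)" "y (k + 1) = cos z"
      by (simp_all add: y_def z_def algebra_simps)
    then show "y k + y (k + 2) = (2 - g_fun x) * y (k + 1)"
      by (simp add: cos_add cos_diff g_fun_cos)
  next
    have "0 \<le> x" "x < pi"
      using n j d_pt_nonneg[of j n] d_pt_less_pi[of j n] by (auto simp: x_def m)
    then have "0 < cos (x / 2)"
      by (intro cos_gt_zero_pi) auto
    then show "y (0 + 1) \<noteq> 0" by (simp add: y_def)
  qed (use n yn yn1 y0 in auto)
  then show ?thesis by (simp add: x_def)
qed

text \<open>The sine is centred at the midpoint \<open>(n + 1) / 2\<close>, which makes the vector antisymmetric and
  turns the two boundary conditions into one.\<close>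

lemma eigenvalue_sin:
  assumes n: "n \<ge> 3" and x: "0 < x" "x < pi" and root: "sin_boundary \<alpha> n x = 0"
  shows "eigenvalue (L_mat \<alpha> n) (g_fun x)"
proof -
  define y where "y = (\<lambda>k. sin ((real k - (real n + 1) / 2) * x))"
  have yn: "y n = sin (n * x / 2 - x / 2)" and yn1: "y (n + 1) = sin (n * x / 2 + x / 2)"
    by (simp_all add: y_def field_simps)
  have "(real 1 - (real n + 1) / 2) * x = - ((real n - (real n + 1) / 2) * x)"
    "(real 0 - (real n + 1) / 2) * x = - ((real (n + 1) - (real n + 1) / 2) * x)"
    by (simp_all add: field_simps)
  then have y1: "y 1 = - y n" and y0: "y 0 = - y (n + 1)"
    by (simp_all only: y_def sin_minus)
  have "y (n + 1) - y n + \<alpha> * (y n - y 1) = 2 * sin_boundary \<alpha> n x"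
    unfolding y1 unfolding yn yn1 by (simp add: sin_boundary_def sin_add sin_diff algebra_simps)
  then have bd: "y (n + 1) - y n + \<alpha> * (y n - y 1) = 0"
    using root by simp
  show ?thesis
  proof (rule L_mat_eigenvalueI[OF n, where y = y and i = "n - 1"])
    fix k
    define z where "z = (real k + 1 - (real n + 1) / 2) * x"
    have "y k = sin (z - x)" "y (k + 2) = sin (z + x)" "y (k + 1) = sin z"
      by (simp_all add: y_def z_def algebra_simps)
    then show "y k + y (k + 2) = (2 - g_fun x) * y (k + 1)"
      by (simp add: sin_add sin_diff g_fun_cos)
  next
    show "y 0 - y 1 + \<alpha> * (y 1 - y n) = 0"
      using bd y0 y1 by (simp add: algebra_simps)
  next
    \<comment> \<open>If the last entry vanished, then by the boundary condition so would the next value of the sine,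
      one step \<open>x\<close> further. This is impossible since \<open>x\<close> lies strictly between \<open>0\<close> and \<open>pi\<close>.\<close>
    show "y (n - 1 + 1) \<noteq> 0"
    proof
      assume "y (n - 1 + 1) = 0"
      then have "y n = 0" using n by simp
      moreover from this have "y (n + 1) = 0" using bd y1 by simp
      moreover have "sin x = sin ((n * x / 2 + x / 2) - (n * x / 2 - x / 2))"
        by simp
      ultimately have "sin x = 0"
        unfolding yn yn1 by (simp only: sin_diff[of "n * x / 2 + x / 2"])
      then show False using sin_gt_zero[OF x] by simp
    qed
  qed (use n bd in auto)
qed

text \<open>This is the antisymmetric eigenvector of imaginary frequency: replacing \<open>x\<close> by \<open>\<i> * t\<close> turns
  \<open>g_fun x\<close> into \<open>- 4 * (sinh (t / 2))\<^sup>2\<close>.\<close>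

lemma eigenvalue_sinh:
  assumes n: "n \<ge> 3" and t: "0 < t" and root: "sinh_boundary \<alpha> n t = 0"
  shows "eigenvalue (L_mat \<alpha> n) (- 4 * (sinh (t / 2))\<^sup>2)"
proof -
  define y where "y = (\<lambda>k. sinh ((real k - (real n + 1) / 2) * t))"
  have yn: "y n = sinh (n * t / 2 - t / 2)" and yn1: "y (n + 1) = sinh (n * t / 2 + t / 2)"
    by (simp_all add: y_def field_simps)
  have "(real 1 - (real n + 1) / 2) * t = - ((real n - (real n + 1) / 2) * t)"
    "(real 0 - (real n + 1) / 2) * t = - ((real (n + 1) - (real n + 1) / 2) * t)"
    by (simp_all add: field_simps)
  then have y1: "y 1 = - y n" and y0: "y 0 = - y (n + 1)"
    by (simp_all only: y_def sinh_minus)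
  have "y (n + 1) - y n + \<alpha> * (y n - y 1) = 2 * sinh_boundary \<alpha> n t"
    unfolding y1 unfolding yn yn1 by (simp add: sinh_boundary_def sinh_add sinh_diff algebra_simps)
  then have bd: "y (n + 1) - y n + \<alpha> * (y n - y 1) = 0"
    using root by simp
  have \<mu>: "- 4 * (sinh (t / 2))\<^sup>2 = 2 - 2 * cosh t"
    using cosh_double[of "t / 2"] cosh_square_eq[of "t / 2"] by simp
  show ?thesis
  proof (rule L_mat_eigenvalueI[OF n, where y = y and i = "n - 1"])
    fix k
    define z where "z = (real k + 1 - (real n + 1) / 2) * t"
    have "y k = sinh (z - t)" "y (k + 2) = sinh (z + t)" "y (k + 1) = sinh z"
      by (simp_all add: y_def z_def algebra_simps)
    then show "y k + y (k + 2) = (2 - - 4 * (sinh (t / 2))\<^sup>2) * y (k + 1)"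
      unfolding \<mu> by (simp add: sinh_add sinh_diff)
  next
    show "y 0 - y 1 + \<alpha> * (y 1 - y n) = 0"
      using bd y0 y1 by (simp add: algebra_simps)
  next
    have "0 < n * t / 2 - t / 2" using n t by (simp add: field_simps)
    then have "0 < y n" unfolding yn by (simp only: sinh_real_pos_iff)
    then show "y (n - 1 + 1) \<noteq> 0" using n by simp
  qed (use n bd in auto)
qed

section \<open>Locating the roots of the boundary equations\<close>

lemma sin_boundary_odd_pt:
  assumes "n > 0"
  shows "sin_boundary \<alpha> n (d_pt n (2 * m + 1)) = (- 1) ^ m * ((1 - \<alpha>) * sin (d_pt n (2 * m + 1) / 2))"
proof -
  have "n * d_pt n (2 * m + 1) / 2 = real m * pi"
    using assms by (simp add: d_pt_def)
  then show ?thesis by (simp add: sin_boundary_def)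
qed

lemma sin_boundary_even_pt:
  assumes "n > 0"
  shows "sin_boundary \<alpha> n (d_pt n (2 * m)) = (- 1) ^ m * (- \<alpha> * cos (d_pt n (2 * m) / 2))"
proof -
  have *: "n * d_pt n (2 * m) / 2 = real m * pi - pi / 2"
    using assms by (simp add: d_pt_def field_simps)
  show ?thesis unfolding sin_boundary_def * by (simp add: sin_diff cos_diff)
qed

lemma root_between:
  fixes f :: "real \<Rightarrow> real"
  assumes "a < b" "f a * f b < 0" "continuous_on {a..b} f"
  obtains x where "a < x" "x < b" "f x = 0"
proof -
  have "\<exists>x. a \<le> x \<and> x \<le> b \<and> f x = 0"
  proof (cases "f a \<le> 0")
    case True
    then have "0 \<le> f b" using assms(2) by (metis linorder_not_less mult_nonpos_nonpos order_less_imp_le)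
    then show ?thesis using IVT'[of f a 0 b] True assms by auto
  next
    case False
    then have "f b \<le> 0" using assms(2) by (smt (verit) mult_pos_pos)
    then show ?thesis using IVT2'[of f b 0 a] False assms by auto
  qed
  then obtain x where x: "a \<le> x" "x \<le> b" "f x = 0" by blast
  moreover from this have "x \<noteq> a" "x \<noteq> b" using assms(2) by auto
  ultimately show thesis using that[of x] by simp
qed

lemma continuous_sin_boundary: "continuous_on S (sin_boundary \<alpha> n)"
  unfolding sin_boundary_def by (intro continuous_intros) auto

lemma continuous_sinh_boundary: "continuous_on S (sinh_boundary \<alpha> n)"
  unfolding sinh_boundary_def by (intro continuous_intros) auto

text \<open>The boundary function has sign \<open>(- 1) ^ m\<close> at \<open>d_pt n (2 * m + 1)\<close> and the opposite sign at the
  next point \<open>d_pt n (2 * m + 2)\<close>. The left end must be positive, since the boundary function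
  vanishes at \<open>0\<close>; hence \<open>j \<ge> 4\<close>.\<close>

lemma eigenvalue_even:
  assumes \<alpha>: "\<alpha> < 0" and n: "n \<ge> 3" and j: "even j" "4 \<le> j" "j \<le> n"
  obtains \<mu> where "eigenvalue (L_mat \<alpha> n) \<mu>" "g_fun (d_pt n (j - 1)) < \<mu>" "\<mu> < g_fun (d_pt n j)"
proof -
  from j(1) obtain i where "j = 2 * i" by (elim evenE)
  with j obtain m where m: "j = 2 * Suc m" "m \<ge> 1" by (cases i) auto
  have j1: "j - 1 = 2 * m + 1" using m by simp
  let ?a = "d_pt n (j - 1)" and ?b = "d_pt n j"
  have ab: "0 < ?a" "?a < ?b" "?b < pi"
    using n j d_pt_mono[of n 1 "j - 1"] d_pt_mono[of n "j - 1" j] d_pt_less_pi[of j n]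
    by (auto simp: d_pt_def)
  have pos: "0 < (1 - \<alpha>) * sin (?a / 2)" "0 < - \<alpha> * cos (?b / 2)"
    using ab \<alpha> by (auto intro!: mult_pos_pos mult_neg_pos sin_gt_zero cos_gt_zero_pi)
  have "sin_boundary \<alpha> n ?a * sin_boundary \<alpha> n ?b
      = - (((- 1) ^ m * (- 1) ^ m) * (((1 - \<alpha>) * sin (?a / 2)) * (- \<alpha> * cos (?b / 2))))"
    using sin_boundary_odd_pt[of n \<alpha> m] sin_boundary_even_pt[of n \<alpha> "Suc m"] n
    unfolding j1 unfolding m(1) by simp
  also have "\<dots> = - (((1 - \<alpha>) * sin (?a / 2)) * (- \<alpha> * cos (?b / 2)))"
    by (simp flip: power_add mult_2)
  also have "\<dots> < 0" using mult_pos_pos[OF pos] by linarith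
  finally obtain x where x: "?a < x" "x < ?b" "sin_boundary \<alpha> n x = 0"
    using root_between[OF ab(2)] continuous_sin_boundary by blast
  show thesis
  proof (rule that)
    show "eigenvalue (L_mat \<alpha> n) (g_fun x)"
      by (rule eigenvalue_sin) (use n x ab in auto)
  qed (use x ab in \<open>auto intro!: g_fun_less\<close>)
qed

text \<open>The boundary function vanishes at \<open>0\<close> without giving an eigenvector there, so the sign at the
  left end of the interval is read off from the slope at \<open>0\<close>. At \<open>d_pt n 2\<close> the function is
  negative.\<close>

lemma eigenvalue_small_positive:
  assumes \<alpha>: "\<alpha> < 0" and n: "n \<ge> 3" and small: "0 < 1 - \<alpha> + \<alpha> * real n"
  obtains \<mu> where "eigenvalue (L_mat \<alpha> n) \<mu>" "0 < \<mu>" "\<mu> < g_fun (d_pt n 2)"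
proof -
  let ?b = "d_pt n 2"
  have b: "0 < ?b" "?b < pi"
    using n d_pt_less_pi[of 2 n] by (auto simp: d_pt_def)
  have "DERIV (sin_boundary \<alpha> n) 0 :> (1 - \<alpha> + \<alpha> * real n) / 2"
    unfolding sin_boundary_def[abs_def]
    by (auto intro!: derivative_eq_intros simp: field_simps)
  then obtain d where d: "0 < d" "\<And>h. 0 < h \<Longrightarrow> h < d \<Longrightarrow> sin_boundary \<alpha> n 0 < sin_boundary \<alpha> n (0 + h)"
    using DERIV_pos_inc_right small by (metis half_gt_zero)
  define a where "a = min d ?b / 2"
  have a: "0 < a" "a < d" "a < ?b" using b d by (auto simp: a_def)
  have "0 < sin_boundary \<alpha> n a"
    using d(2)[of a] a by (simp add: sin_boundary_def)
  moreover have "sin_boundary \<alpha> n ?b < 0"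
  proof -
    have "0 < cos (?b / 2)" using b by (intro cos_gt_zero_pi) auto
    then show ?thesis
      using sin_boundary_even_pt[of n \<alpha> 1] n \<alpha> by (simp add: mult_neg_pos)
  qed
  ultimately obtain x where x: "a < x" "x < ?b" "sin_boundary \<alpha> n x = 0"
    using root_between[OF a(3)] continuous_sin_boundary by (metis mult_pos_neg)
  show thesis
  proof (rule that)
    show "eigenvalue (L_mat \<alpha> n) (g_fun x)"
      by (rule eigenvalue_sin) (use n x a b in auto)
    show "0 < g_fun x"
      using g_fun_less[of 0 x] x a b by (simp add: g_fun_def)
  qed (use x a b in \<open>auto intro!: g_fun_less\<close>)
qed

text \<open>The root equation says that \<open>tanh (t / 2)\<close> is \<open>- \<alpha> / (1 - \<alpha>)\<close> times \<open>tanh (n * t / 2)\<close>, which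
  is less than \<open>- \<alpha> / (1 - \<alpha>)\<close>. The bound \<open>Omega \<alpha>\<close> is the value of \<open>- 4 * (sinh (t / 2))\<^sup>2\<close>
  at the point where \<open>tanh (t / 2)\<close> equals \<open>- \<alpha> / (1 - \<alpha>)\<close>.\<close>

lemma eigenvalue_negative:
  assumes \<alpha>: "\<alpha> < 0" and n: "n \<ge> 3" and large: "1 - \<alpha> + \<alpha> * real n < 0"
  obtains \<mu> where "eigenvalue (L_mat \<alpha> n) \<mu>" "Omega \<alpha> < \<mu>" "\<mu> < 0"
proof -
  \<comment> \<open>The right end \<open>b\<close> is the point where \<open>tanh (b / 2) = - \<alpha> / (1 - \<alpha>)\<close>; then \<open>s\<close> is
    \<open>sinh (b / 2)\<close>.\<close>
  define s where "s = - \<alpha> / sqrt (1 - 2 * \<alpha>)"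
  define b where "b = 2 * arsinh s"
  have s: "0 < s" using \<alpha> by (simp add: s_def divide_neg_pos)
  then have b: "0 < b" by (simp add: b_def)
  have sb: "sinh (b / 2) = s" by (simp add: b_def)
  have s2: "s\<^sup>2 = \<alpha>\<^sup>2 / (1 - 2 * \<alpha>)" using \<alpha> by (simp add: s_def power_divide)
  have cb: "cosh (b / 2) = (1 - \<alpha>) / sqrt (1 - 2 * \<alpha>)"
  proof (rule power2_eq_imp_eq)
    have "(cosh (b / 2))\<^sup>2 = s\<^sup>2 + 1" using cosh_square_eq[of "b / 2"] sb by simp
    also have "\<dots> = ((1 - \<alpha>) / sqrt (1 - 2 * \<alpha>))\<^sup>2"
      using \<alpha> unfolding s2 by (simp add: power_divide field_simps power2_eq_square)
    finally show "(cosh (b / 2))\<^sup>2 = ((1 - \<alpha>) / sqrt (1 - 2 * \<alpha>))\<^sup>2" .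
  qed (use \<alpha> in auto)
  have factor: "\<alpha> * S * ((1 - \<alpha>) * r) + (1 - \<alpha>) * C * (- \<alpha> * r) = - \<alpha> * (1 - \<alpha>) * r * (C - S)"
    for r C S :: real by (simp add: algebra_simps)
  have "sinh_boundary \<alpha> n b = - \<alpha> * (1 - \<alpha>) / sqrt (1 - 2 * \<alpha>) * (cosh (n * b / 2) - sinh (n * b / 2))"
    unfolding sinh_boundary_def cb sb s_def unfolding divide_inverse by (rule factor)
  also have "\<dots> > 0"
    using \<alpha> by (intro mult_pos_pos divide_pos_pos) (auto simp: cosh_minus_sinh mult_neg_pos)
  finally have fb: "0 < sinh_boundary \<alpha> n b" .
  have "DERIV (sinh_boundary \<alpha> n) 0 :> (1 - \<alpha> + \<alpha> * real n) / 2"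
    unfolding sinh_boundary_def[abs_def]
    by (auto intro!: derivative_eq_intros simp: field_simps)
  then obtain d where d: "0 < d" "\<And>h. 0 < h \<Longrightarrow> h < d \<Longrightarrow> sinh_boundary \<alpha> n (0 + h) < sinh_boundary \<alpha> n 0"
    using DERIV_neg_dec_right[of "sinh_boundary \<alpha> n" "(1 - \<alpha> + \<alpha> * real n) / 2" 0] large by auto
  define a where "a = min d b / 2"
  have a: "0 < a" "a < d" "a < b" using b d by (auto simp: a_def)
  have "sinh_boundary \<alpha> n a < 0"
    using d(2)[of a] a by (simp add: sinh_boundary_def)
  with fb obtain t where t: "a < t" "t < b" "sinh_boundary \<alpha> n t = 0"
    using root_between[OF a(3)] continuous_sinh_boundary by (metis mult_neg_pos)
  show thesis
  proof (rule that)
    show "eigenvalue (L_mat \<alpha> n) (- 4 * (sinh (t / 2))\<^sup>2)"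
      by (rule eigenvalue_sinh) (use n t a in auto)
    have pos: "0 < sinh (t / 2)" using t a by simp
    then show "- 4 * (sinh (t / 2))\<^sup>2 < 0" by simp
    have "sinh (t / 2) < s" unfolding sb[symmetric] using t by simp
    then have "(sinh (t / 2))\<^sup>2 < s\<^sup>2" using pos by (intro power_strict_mono) auto
    moreover have "Omega \<alpha> = - 4 * s\<^sup>2"
      using \<alpha> unfolding s2 Omega_def by (simp add: field_simps)
    ultimately show "Omega \<alpha> < - 4 * (sinh (t / 2))\<^sup>2" by simp
  qed
qed

section \<open>The ordered spectrum\<close>

lemma upper_eigenvalue:
  assumes "\<alpha> < 0" "n \<ge> 3" "3 \<le> j" "j \<le> n"
  shows "\<exists>\<mu>. eigenvalue (L_mat \<alpha> n) \<mu> \<and> (odd j \<longrightarrow> \<mu> = g_fun (d_pt n j)) \<and>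
    (even j \<longrightarrow> g_fun (d_pt n (j - 1)) < \<mu> \<and> \<mu> < g_fun (d_pt n j))"
proof (cases "odd j")
  case True
  then show ?thesis using eigenvalue_cos assms by auto
next
  case False
  then have "4 \<le> j" using assms(3) by (cases "j = 3") auto
  then show ?thesis using eigenvalue_even[of \<alpha> n j] assms False by (metis (no_types))
qed

text \<open>Above \<open>g_fun (d_pt n 2)\<close> the spectrum looks the same in all cases, so only the two lowest eigenvalues
  have to be supplied. They and the eigenvalues for \<open>j \<ge> 3\<close> are strictly increasing except possibly
  for \<open>a = b\<close>, so that a multiplicity above one has to be verified only there.\<close>

lemma spectrum_eqI:
  assumes \<alpha>: "\<alpha> < 0" and n: "n \<ge> 3"
    and a: "eigenvalue (L_mat \<alpha> n) a" and b: "eigenvalue (L_mat \<alpha> n) b"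
    and ab: "a \<le> b" "b < g_fun (d_pt n 2)"
    and double: "a = b \<Longrightarrow> 2 \<le> order a (char_poly (L_mat \<alpha> n))"
  shows "eigval \<alpha> n 1 = a \<and> eigval \<alpha> n 2 = b \<and> (\<forall>j. 3 \<le> j \<and> j \<le> n \<longrightarrow>
    (odd j \<longrightarrow> eigval \<alpha> n j = g_fun (d_pt n j)) \<and>
    (even j \<longrightarrow> g_fun (d_pt n (j - 1)) < eigval \<alpha> n j \<and> eigval \<alpha> n j < g_fun (d_pt n j)))"
proof -
  let ?p = "char_poly (L_mat \<alpha> n)"
  have "\<exists>\<mu>. \<forall>j\<in>{3..n}. eigenvalue (L_mat \<alpha> n) (\<mu> j) \<and> (odd j \<longrightarrow> \<mu> j = g_fun (d_pt n j)) \<and>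
      (even j \<longrightarrow> g_fun (d_pt n (j - 1)) < \<mu> j \<and> \<mu> j < g_fun (d_pt n j))"
    using upper_eigenvalue[OF \<alpha> n] by (intro bchoice) auto
  then obtain \<mu> where ex: "\<forall>j\<in>{3..n}. eigenvalue (L_mat \<alpha> n) (\<mu> j) \<and> (odd j \<longrightarrow> \<mu> j = g_fun (d_pt n j)) \<and>
      (even j \<longrightarrow> g_fun (d_pt n (j - 1)) < \<mu> j \<and> \<mu> j < g_fun (d_pt n j))" ..
  have \<mu>: "\<And>j. 3 \<le> j \<Longrightarrow> j \<le> n \<Longrightarrow> eigenvalue (L_mat \<alpha> n) (\<mu> j)"
      "\<And>j. 3 \<le> j \<Longrightarrow> j \<le> n \<Longrightarrow> odd j \<Longrightarrow> \<mu> j = g_fun (d_pt n j)"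
      "\<And>j. 3 \<le> j \<Longrightarrow> j \<le> n \<Longrightarrow> even j \<Longrightarrow> g_fun (d_pt n (j - 1)) < \<mu> j \<and> \<mu> j < g_fun (d_pt n j)"
    using ex by simp_all
  have g_step: "g_fun (d_pt n j) < g_fun (d_pt n (Suc j))" if "1 \<le> j" "Suc j \<le> n" for j
    using that n d_pt_nonneg d_pt_mono d_pt_less_pi[of "Suc j" n] by (intro g_fun_less) auto
  have step: "\<mu> j < \<mu> (Suc j)" if "3 \<le> j" "Suc j \<le> n" for j
    using \<mu>(2,3)[of j] \<mu>(2,3)[of "Suc j"] g_step[of j] that by (cases "even j") auto
  have b3: "b < \<mu> 3"
  proof -
    have "odd (3 :: nat)" by simp
    then have "\<mu> 3 = g_fun (d_pt n 3)" using \<mu>(2)[of 3] n by simp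
    moreover have "g_fun (d_pt n 2) < g_fun (d_pt n 3)" using g_step[of 2] n by simp
    ultimately show ?thesis using ab(2) by linarith
  qed
  define ys where "ys = map \<mu> [3..<Suc n]"
  have "sorted_wrt (<) ys"
    unfolding ys_def sorted_wrt_map
  proof (rule sorted_wrt_mono_rel[OF _ sorted_wrt_upt])
    fix i j assume "i \<in> set [3..<Suc n]" "j \<in> set [3..<Suc n]" "i < j"
    then have "Suc i \<le> j" "j \<le> n" "3 \<le> i" by auto
    then show "\<mu> i < \<mu> j"
      by (induction j rule: dec_induct) (use step in \<open>auto intro: less_trans\<close>)
  qed
  moreover have "\<forall>y\<in>set ys. b < y"
  proof
    fix y assume "y \<in> set ys"
    then obtain j where j: "3 \<le> j" "j \<le> n" "y = \<mu> j" by (auto simp: ys_def)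
    from j(1,2) have "b < \<mu> j"
      by (induction j rule: dec_induct) (use b3 step in \<open>auto intro: less_trans\<close>)
    then show "b < y" using j by simp
  qed
  ultimately have by_sorted: "sorted_wrt (<) (b # ys)" by simp
  then have distinct: "distinct (b # ys)" using strict_sorted_iff by blast
  have "eigenvalue_list (L_mat \<alpha> n) = a # b # ys"
  proof (rule eigenvalue_list_eqI[OF L_mat_carrier L_mat_symmetric])
    show "length (a # b # ys) = n" using n by (simp add: ys_def)
    show "sorted (a # b # ys)"
      using by_sorted ab(1) strict_sorted_imp_sorted[OF by_sorted] by auto
    fix z assume z: "z \<in> set (a # b # ys)"
    then have "eigenvalue (L_mat \<alpha> n) z" using a b \<mu>(1) by (auto simp: ys_def)
    then have "poly ?p z = 0"
      by (simp add: eigenvalue_root_char_poly[OF L_mat_carrier])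
    moreover have "?p \<noteq> 0"
      using degree_monic_char_poly[OF L_mat_carrier[of \<alpha> n]] by auto
    ultimately have ord: "1 \<le> order z ?p"
      by (simp add: order_root Suc_le_eq)
    have le1: "count (mset (b # ys)) z \<le> 1"
      using distinct by (simp add: distinct_count_atmost_1 del: mset.simps)
    show "count (mset (a # b # ys)) z \<le> order z ?p"
    proof (cases "z = a \<and> a = b")
      case True
      then have "2 \<le> order z ?p" using double by simp
      moreover have "count (mset (a # b # ys)) z \<le> Suc (count (mset (b # ys)) z)" by simp
      ultimately show ?thesis using le1 by linarith
    next
      case False
      have "z = a \<Longrightarrow> z \<notin> set (b # ys)"
        using False by_sorted ab(1) by fastforce
      then have "count (mset (a # b # ys)) z \<le> 1"
        using le1 by (cases "z = a") (auto simp: not_in_iff[symmetric] simp del: distinct.simps)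
      then show ?thesis using ord by simp
    qed
  qed
  moreover have "(a # b # ys) ! (j - 1) = \<mu> j" if "3 \<le> j" "j \<le> n" for j
  proof -
    have "j - 1 = Suc (Suc (j - 3))" using that by simp
    then show ?thesis using that by (simp add: ys_def nth_map_upt del: upt_Suc)
  qed
  ultimately have "eigval \<alpha> n 1 = a" "eigval \<alpha> n 2 = b"
    "\<And>j. 3 \<le> j \<Longrightarrow> j \<le> n \<Longrightarrow> eigval \<alpha> n j = \<mu> j"
    by (simp_all add: eigval_def)
  then show ?thesis using \<mu> by auto
qed

theorem theorem2p1:
  fixes \<alpha> :: real and n :: nat
  assumes "\<alpha> < 0" and "n \<ge> 3"
  shows "(real n < kappa \<alpha> \<longrightarrow>
            eigval \<alpha> n 1 = 0 \<and> 0 < eigval \<alpha> n 2 \<and> eigval \<alpha> n 2 < g_fun (d_pt n 2)) \<and>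
         (real n = kappa \<alpha> \<longrightarrow>
            eigval \<alpha> n 1 = 0 \<and> eigval \<alpha> n 2 = 0) \<and>
         (real n > kappa \<alpha> \<longrightarrow>
            Omega \<alpha> < eigval \<alpha> n 1 \<and> eigval \<alpha> n 1 < 0 \<and> eigval \<alpha> n 2 = 0) \<and>
         (\<forall>j::nat. 3 \<le> j \<and> j \<le> n \<longrightarrow>
            (odd j \<longrightarrow> eigval \<alpha> n j = g_fun (d_pt n j)) \<and>
            (even j \<longrightarrow> g_fun (d_pt n (j - 1)) < eigval \<alpha> n j \<and> eigval \<alpha> n j < g_fun (d_pt n j)))"
proof -
  have zero: "eigenvalue (L_mat \<alpha> n) 0" by (rule eigenvalue_zero[OF assms(2)])
  have g2: "0 < g_fun (d_pt n 2)"
    using g_fun_less[of 0 "d_pt n 2"] d_pt_less_pi[of 2 n] assms(2)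
    by (simp add: d_pt_def) (simp add: g_fun_def)
  consider "real n < kappa \<alpha>" | "real n = kappa \<alpha>" | "real n > kappa \<alpha>" by linarith
  then show ?thesis
  proof cases
    case 1
    then have "0 < 1 - \<alpha> + \<alpha> * real n"
      using assms(1) by (simp add: kappa_def field_simps)
    then obtain b where "eigenvalue (L_mat \<alpha> n) b" "0 < b" "b < g_fun (d_pt n 2)"
      using eigenvalue_small_positive assms by blast
    then show ?thesis using spectrum_eqI[OF assms zero, of b] 1 by auto
  next
    case 2
    then have "\<alpha> * (1 - real n) = 1"
      using assms(1) by (simp add: kappa_def field_simps)
    then show ?thesis
      using spectrum_eqI[OF assms zero zero _ g2] order_zero_ge_2[OF assms(2)] 2 by auto
  next
    case 3
    then have "1 - \<alpha> + \<alpha> * real n < 0"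
      using assms(1) by (simp add: kappa_def field_simps)
    then obtain a where "eigenvalue (L_mat \<alpha> n) a" "Omega \<alpha> < a" "a < 0"
      using eigenvalue_negative assms by blast
    then show ?thesis using spectrum_eqI[OF assms _ zero _ g2, of a] 3 by auto
  qed
qed

end
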